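(* Let $M, K, L \ge 1$. For any sequence of complex numbers $a_{k,l}$ supported on positive integers $k \le K$ and $l \le L$, we have $$\sum_{M < m \le 2M}\ \sum_{\substack{\nu \bmod m\\ \nu^3 \equiv 2 \ (m)}} \left| \sum_k \sum_l a_{k,l}\, e\left( \frac{k\nu + l \nu^2}{m} \right) \right|^2 \ll (M + K)(M + L) \sum_k\sum_l |a_{k,l}|^2,$$ where $e(x) = e^{2\pi i x}$, $m$ runs over integers, and the implied constant is absolute. *)

theory Defs
  imports Complex_Main "HOL-Number_Theory.Cong"
begin

definition e :: "real \<Rightarrow> complex" where
  "e x = exp (2 * of_real pi * \<i> * of_real x)"

(* The residue classes nu mod m with nu^3 = 2 (mod m), each given by its least
   nonnegative representative; e ((k nu + l nu^2) / m) depends only on the class. *)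
definition cube_roots_of_2_mod :: "int \<Rightarrow> int set" where
  "cube_roots_of_2_mod m = {\<nu>. 0 \<le> \<nu> \<and> \<nu> < m \<and> [\<nu> ^ 3 = 2] (mod m)}"

end

theory Submission
  imports Defs "HOL-Analysis.Complex_Transcendental"
begin

text \<open>
  The points \<open>(\<nu>/m, \<nu>\<^sup>2/m)\<close> are separated modulo \<open>\<int>\<^sup>2\<close> at scale \<open>1/M\<close>. The cubic form
  \<open>F(a, b, c) = 4a\<^sup>3 + 2b\<^sup>3 + c\<^sup>3 - 6abc\<close> is, up to scaling and a change of coordinates, the norm
  form of \<open>\<rat>(\<theta>)\<close>, \<open>\<theta>\<^sup>3 = 2\<close>, on the dual of \<open>\<int>[\<theta>]\<close>, and \<open>(1, \<nu>, \<nu>\<^sup>2)/m\<close> is a vector of the dual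
  of the ideal \<open>(m, \<nu> - \<theta>)\<close>. Hence on a difference \<open>u\<close> of two such vectors, with moduli \<open>m\<close> and
  \<open>n\<close>, shifted by an element of \<open>\<int>\<^sup>3\<close>, the value \<open>F(u)\<close> lies in \<open>(mn)\<^sup>-\<^sup>1\<int>\<close>, and it vanishes only for
  \<open>u = 0\<close>. If the first entry of \<open>u\<close> is \<open>1/m - 1/n\<close> and the other two are at most \<open>1/(8M)\<close> in absolute
  value, then \<open>|F(u)| < 1/(mn)\<close>, so \<open>u = 0\<close>.

  The two-dimensional large sieve for such points follows by rounding each point to a grid of
  step \<open>1/N\<^sub>1\<close>, \<open>1/N\<^sub>2\<close> with \<open>N\<^sub>1 \<approx> M + K\<close>, \<open>N\<^sub>2 \<approx> M + L\<close>, where Parseval's identity is exact, and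
  expanding the rounding error in a Taylor series, whose terms only rescale the coefficients
  by factors of modulus at most 1.
\<close>

section \<open>Mean squares of sums twisted by exponentials\<close>

lemma sum_weighted_square_le:
  fixes w t :: "'i \<Rightarrow> real"
  assumes "\<And>i. i \<in> I \<Longrightarrow> 0 \<le> w i"
  shows "(\<Sum>i\<in>I. w i * t i)\<^sup>2 \<le> (\<Sum>i\<in>I. w i) * (\<Sum>i\<in>I. w i * (t i)\<^sup>2)"
proof -
  have "(\<Sum>i\<in>I. sqrt (w i) * (sqrt (w i) * t i))\<^sup>2
      \<le> (\<Sum>i\<in>I. (sqrt (w i))\<^sup>2) * (\<Sum>i\<in>I. (sqrt (w i) * t i)\<^sup>2)"
    by (rule Cauchy_Schwarz_ineq_sum)
  then show ?thesis
    using assms by (simp add: power_mult_distrib flip: mult.assoc)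
qed

text \<open>In the Taylor series of \<open>exp (h k * z r)\<close> the factor
  \<open>z r ^ j / fact j\<close> leaves the sum over \<open>k\<close>, so only the twists by
  \<open>h k ^ j\<close> remain, and \<open>B\<close> bounds these uniformly in \<open>j\<close>.
  The weights \<open>c ^ j / fact j\<close> add up to at most \<open>exp c\<close>, and this total
  enters twice: once in Cauchy-Schwarz and once when the bounds \<open>B\<close> are summed.\<close>

lemma sum_norm_square_exp_le:
  fixes A :: "'r \<Rightarrow> 'k \<Rightarrow> complex" and h :: "'k \<Rightarrow> complex" and z :: "'r \<Rightarrow> complex"
  assumes R: "finite R"
    and z: "\<And>r. r \<in> R \<Longrightarrow> norm (z r) \<le> c"
    and c: "0 \<le> c"
    and B: "\<And>j. (\<Sum>r\<in>R. (norm (\<Sum>k\<in>S. h k ^ j * A r k))\<^sup>2) \<le> B"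
  shows "(\<Sum>r\<in>R. (norm (\<Sum>k\<in>S. exp (h k * z r) * A r k))\<^sup>2) \<le> exp (2 * c) * B"
proof -
  define X where "X j r = (\<Sum>k\<in>S. h k ^ j * A r k)" for j r
  define w where "w j = c ^ j / fact j" for j
  \<comment> \<open>The series is truncated so that all interchanges of sums are finite; the bound
    does not depend on \<open>n\<close> and passes to the limit at the end.\<close>
  define P where "P n r = (\<Sum>k\<in>S. (\<Sum>j<n. (h k * z r) ^ j /\<^sub>R fact j) * A r k)" for n r
  have w0: "0 \<le> w j" for j
    using c by (simp add: w_def)
  have B0: "0 \<le> B"
    using order_trans[OF sum_nonneg B[of 0]] by simp
  have w_le: "(\<Sum>j<n. w j) \<le> exp c" for n
    using sum_le_suminf[OF summable_exp_generic[of c], of "{..<n}"] w0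
    by (simp add: w_def exp_def divide_inverse mult.commute)
  have P_eq: "P n r = (\<Sum>j<n. (z r ^ j /\<^sub>R fact j) * X j r)" for n r
    unfolding P_def X_def sum_distrib_left sum_distrib_right
    by (subst sum.swap) (simp add: power_mult_distrib algebra_simps)
  have bound: "(norm (P n r))\<^sup>2 \<le> exp c * (\<Sum>j<n. w j * (norm (X j r))\<^sup>2)" if "r \<in> R" for n r
  proof -
    have "norm (P n r) \<le> (\<Sum>j<n. w j * norm (X j r))"
      unfolding P_eq
    proof (rule sum_norm_le)
      fix j
      have "norm (z r) ^ j \<le> c ^ j"
        using z[OF that] by (intro power_mono) auto
      then show "norm ((z r ^ j /\<^sub>R fact j) * X j r) \<le> w j * norm (X j r)"
        by (simp add: w_def norm_mult norm_power divide_simps mult_right_mono)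
    qed
    then have "(norm (P n r))\<^sup>2 \<le> (\<Sum>j<n. w j * norm (X j r))\<^sup>2"
      by (intro power_mono) auto
    also have "\<dots> \<le> (\<Sum>j<n. w j) * (\<Sum>j<n. w j * (norm (X j r))\<^sup>2)"
      using w0 by (rule sum_weighted_square_le)
    also have "\<dots> \<le> exp c * (\<Sum>j<n. w j * (norm (X j r))\<^sup>2)"
      using w_le w0 by (intro mult_right_mono sum_nonneg) auto
    finally show ?thesis .
  qed
  have partial: "(\<Sum>r\<in>R. (norm (P n r))\<^sup>2) \<le> exp (2 * c) * B" for n
  proof -
    have "(\<Sum>r\<in>R. (norm (P n r))\<^sup>2) \<le> (\<Sum>r\<in>R. exp c * (\<Sum>j<n. w j * (norm (X j r))\<^sup>2))"
      by (intro sum_mono bound)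
    also have "\<dots> = exp c * (\<Sum>j<n. w j * (\<Sum>r\<in>R. (norm (X j r))\<^sup>2))"
      unfolding sum_distrib_left by (rule sum.swap)
    also have "\<dots> \<le> exp c * (\<Sum>j<n. w j * B)"
      using B w0 by (intro mult_left_mono sum_mono) (auto simp: X_def)
    also have "\<dots> = exp c * (\<Sum>j<n. w j) * B"
      by (simp add: sum_distrib_right)
    also have "\<dots> \<le> exp c * exp c * B"
      using w_le B0 by (intro mult_right_mono mult_left_mono) auto
    finally show ?thesis
      by (simp add: mult_exp_exp)
  qed
  have "(\<lambda>n. P n r) \<longlonglongrightarrow> (\<Sum>k\<in>S. exp (h k * z r) * A r k)" for r
    unfolding P_def
    by (intro tendsto_sum tendsto_mult tendsto_const)
       (use exp_converges in \<open>auto simp: sums_def\<close>)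
  then have "(\<lambda>n. \<Sum>r\<in>R. (norm (P n r))\<^sup>2)
      \<longlonglongrightarrow> (\<Sum>r\<in>R. (norm (\<Sum>k\<in>S. exp (h k * z r) * A r k))\<^sup>2)"
    by (intro tendsto_intros)
  then show ?thesis
    by (rule LIMSEQ_le_const2) (use partial in blast)
qed

section \<open>Additive characters and Parseval's identity on a grid\<close>

lemma e_add: "e (x + y) = e x * e y"
  by (simp add: e_def algebra_simps exp_add)

lemma e_of_int [simp]: "e (of_int n) = 1"
  using exp_integer_2pi[of "of_int n"] by (simp add: e_def mult_ac)

lemma cnj_e: "cnj (e x) = e (- x)"
  by (simp add: e_def exp_cnj)

lemma e_of_nat_mult: "e (of_nat n * x) = e x ^ n"
  by (simp add: e_def mult_ac flip: exp_of_nat_mult)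

lemma sum_e_multiples:
  fixes N :: nat and d :: int
  assumes "N > 0"
  shows "(\<Sum>g<N. e (of_int d * real g / real N)) = (if int N dvd d then of_nat N else 0)"
proof -
  define q where "q = e (of_int d / real N)"
  have sum_eq: "(\<Sum>g<N. e (of_int d * real g / real N)) = (\<Sum>g<N. q ^ g)"
    unfolding q_def by (intro sum.cong) (simp_all add: mult_ac flip: e_of_nat_mult)
  have q_N: "q ^ N = 1"
    using assms by (simp add: q_def flip: e_of_nat_mult)
  show ?thesis
  proof (cases "q = 1")
    case True
    then have "exp (2 * of_real pi * \<i> * of_real (of_int d / real N)) = 1"
      by (simp add: q_def e_def)
    then obtain n :: int where "2 * pi * (of_int d / real N) = of_int (2 * n) * pi"
      by (auto simp: exp_eq_1)
    then have "of_int d = (of_int (n * int N) :: real)"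
      using assms by (simp add: field_simps)
    then have "d = n * int N"
      by (simp only: of_int_eq_iff)
    then show ?thesis
      unfolding sum_eq using True by simp
  next
    case False
    have "\<not> int N dvd d"
    proof
      assume "int N dvd d"
      then obtain n where "d = int N * n" ..
      then have "q = 1"
        using assms by (simp add: q_def)
      with False show False ..
    qed
    then show ?thesis
      using False q_N by (simp add: sum_eq geometric_sum)
  qed
qed

text \<open>All frequencies lie in one period \<open>{1..N}\<close>, so distinct ones are
  incongruent modulo \<open>N\<close> and the characters are exactly orthogonal on the grid.\<close>

lemma parseval_grid:
  fixes b :: "nat \<Rightarrow> complex"
  assumes N: "N > 0" and S: "S \<subseteq> {1..N}"
  shows "(\<Sum>g<N. (norm (\<Sum>k\<in>S. b k * e (real k * real g / real N)))\<^sup>2)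
    = real N * (\<Sum>k\<in>S. (norm (b k))\<^sup>2)"
proof -
  have fin: "finite S"
    using S finite_subset by blast
  have orth: "int N dvd int k - int k' \<longleftrightarrow> k = k'" if "k \<in> S" "k' \<in> S" for k k'
  proof
    assume "int N dvd int k - int k'"
    moreover have "\<bar>int k - int k'\<bar> < int N"
      using S[THEN subsetD, OF that(1)] S[THEN subsetD, OF that(2)] by auto
    ultimately show "k = k'"
      using zdvd_not_zless[of "\<bar>int k - int k'\<bar>" "int N"] by fastforce
  qed simp
  have e_diff: "e (real k * real g / real N) * (z * e (- (real k' * real g / real N)))
      = z * e ((real k - real k') * real g / real N)" for k k' g z
  proof -
    have "(real k - real k') * real g / real N = real k * real g / real N + - (real k' * real g / real N)"
      by (simp add: diff_divide_distrib left_diff_distrib)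
    then show ?thesis
      by (simp only: e_add mult_ac)
  qed
  have "of_real (\<Sum>g<N. (norm (\<Sum>k\<in>S. b k * e (real k * real g / real N)))\<^sup>2)
    = (\<Sum>g<N. \<Sum>k\<in>S. \<Sum>k'\<in>S. b k * cnj (b k') * e (of_int (int k - int k') * real g / real N))"
    unfolding of_real_sum complex_norm_square cnj_sum sum_product
    by (intro sum.cong refl)
       (simp add: cnj_e e_diff)
  also have "\<dots> = (\<Sum>k\<in>S. \<Sum>k'\<in>S. b k * cnj (b k') *
      (\<Sum>g<N. e (of_int (int k - int k') * real g / real N)))"
    unfolding sum_distrib_left
    by (subst sum.swap) (intro sum.cong refl sum.swap)
  also have "\<dots> = (\<Sum>k\<in>S. \<Sum>k'\<in>S. if k = k' then of_nat N * (b k * cnj (b k)) else 0)"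
    unfolding sum_e_multiples[OF N] using orth by (intro sum.cong refl) simp
  also have "\<dots> = of_real (real N * (\<Sum>k\<in>S. (norm (b k))\<^sup>2))"
    using fin by (simp add: sum_distrib_left complex_norm_square del: of_real_power)
  finally show ?thesis
    by (simp only: of_real_eq_iff)
qed


section \<open>The two-dimensional large sieve\<close>

text \<open>The hypothesis \<open>inj\<close> puts at most one point in each cell of the torus. Each
  coordinate has a rounding phase of modulus at most \<open>2 * pi\<close> and costs a factor
  \<open>exp (4 * pi)\<close>.\<close>

theorem large_sieve_grid:
  fixes a :: "nat \<Rightarrow> nat \<Rightarrow> complex" and x y :: "'r \<Rightarrow> real"
  assumes R: "finite R" and N1: "N1 > 0" and N2: "N2 > 0"
    and S: "S \<subseteq> {1..N1}" and T: "T \<subseteq> {1..N2}"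
    and inj: "inj_on (\<lambda>r. (\<lfloor>real N1 * x r\<rfloor> mod int N1, \<lfloor>real N2 * y r\<rfloor> mod int N2)) R"
  shows "(\<Sum>r\<in>R. (norm (\<Sum>k\<in>S. \<Sum>l\<in>T. a k l * e (real k * x r + real l * y r)))\<^sup>2)
    \<le> exp (8 * pi) * real N1 * real N2 * (\<Sum>k\<in>S. \<Sum>l\<in>T. (norm (a k l))\<^sup>2)"
proof -
  define D where "D = (\<Sum>k\<in>S. \<Sum>l\<in>T. (norm (a k l))\<^sup>2)"
  define g where "g = (\<lambda>N (u::real). nat (\<lfloor>real N * u\<rfloor> mod int N))"
  define z where "z = (\<lambda>N u. 2 * of_real pi * \<i> * of_real (frac (real N * u)))"
  \<comment> \<open>Write \<open>N * u\<close> as its fractional part plus a multiple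
    \<open>q * N\<close> plus the cell index \<open>g N u\<close>. The multiple contributes the
    trivial phase \<open>e (k * q) = 1\<close>, and the fractional part becomes the exponential to
    be expanded.\<close>
  have split: "e (real k * u) = exp (of_real (real k / real N) * z N u) * e (real k * real (g N u) / real N)"
    if "N > 0" for k N u
  proof -
    define q where "q = \<lfloor>real N * u\<rfloor> div int N"
    have "\<lfloor>real N * u\<rfloor> = q * int N + int (g N u)"
      using that by (simp add: g_def q_def)
    then have "real_of_int \<lfloor>real N * u\<rfloor> = of_int q * real N + real (g N u)"
      by (metis of_int_add of_int_mult of_int_of_nat_eq)
    then have "real N * u = frac (real N * u) + of_int q * real N + real (g N u)"
      by (simp add: frac_def)
    then have "real k / real N * (real N * u)
        = real k / real N * (frac (real N * u) + of_int q * real N + real (g N u))"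
      by (rule arg_cong)
    then have "real k * u = real k / real N * frac (real N * u) + real k * real (g N u) / real N
        + of_int (int k * q)"
      using that by (simp add: distrib_left)
    then have "e (real k * u) = e (real k / real N * frac (real N * u)) * e (real k * real (g N u) / real N)"
      by (simp only: e_add e_of_int mult_1_right)
    then show ?thesis
      by (simp add: e_def z_def mult_ac)
  qed
  have z_le: "norm (z N u) \<le> 2 * pi" for N u
    using frac_lt_1[of "real N * u"] frac_ge_0[of "real N * u"]
    by (simp add: z_def norm_mult)
  have fin: "finite S" "finite T"
    using S T finite_subset by blast+
  have g_inj: "inj_on (\<lambda>r. (g N1 (x r), g N2 (y r))) R"
    using inj N1 N2 by (simp add: inj_on_def g_def eq_nat_nat_iff)
  have g_less: "g N u < N" if "N > 0" for N u
    using that by (simp add: g_def nat_less_iff)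
  \<comment> \<open>General coefficients \<open>b\<close> dominated by \<open>a\<close> are allowed
    because the Taylor terms multiply \<open>a k l\<close> by powers of \<open>k / N1\<close> and
    \<open>l / N2\<close>, which are at most 1.\<close>
  have grid: "(\<Sum>r\<in>R. (norm (\<Sum>k\<in>S. \<Sum>l\<in>T. b k l *
      (e (real l * real (g N2 (y r)) / real N2) * e (real k * real (g N1 (x r)) / real N1))))\<^sup>2)
      \<le> real N1 * real N2 * D" if b: "\<And>k l. k \<in> S \<Longrightarrow> l \<in> T \<Longrightarrow> norm (b k l) \<le> norm (a k l)" for b
  proof -
    define G where "G p = (norm (\<Sum>k\<in>S. \<Sum>l\<in>T. b k l *
      (e (real l * real (snd p) / real N2) * e (real k * real (fst p) / real N1))))\<^sup>2"
      for p :: "nat \<times> nat"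
    have G0: "0 \<le> G p" for p
      by (simp add: G_def)
    have "(\<Sum>r\<in>R. G (g N1 (x r), g N2 (y r))) = sum G ((\<lambda>r. (g N1 (x r), g N2 (y r))) ` R)"
      by (simp add: sum.reindex[OF g_inj] o_def)
    also have "\<dots> \<le> sum G ({..<N1} \<times> {..<N2})"
      using G0 g_less N1 N2 by (intro sum_mono2) auto
    also have "\<dots> = (\<Sum>i<N1. \<Sum>j<N2. (norm (\<Sum>k\<in>S. (\<Sum>l\<in>T. b k l * e (real l * real j / real N2))
        * e (real k * real i / real N1)))\<^sup>2)"
      by (simp only: sum.cartesian_product' G_def fst_conv snd_conv sum_distrib_right mult.assoc)
    \<comment> \<open>Parseval in \<open>k\<close> for each fixed \<open>j\<close>, with the inner
      sums over \<open>l\<close> as coefficients; Parseval in \<open>l\<close> follows.\<close>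
    also have "\<dots> = real N1 * (\<Sum>k\<in>S. \<Sum>j<N2. (norm (\<Sum>l\<in>T. b k l * e (real l * real j / real N2)))\<^sup>2)"
      unfolding sum.swap[where A = "{..<N1}"] sum.swap[where A = S] parseval_grid[OF N1 S]
      by (rule sum_distrib_left[symmetric])
    also have "\<dots> = real N1 * real N2 * (\<Sum>k\<in>S. \<Sum>l\<in>T. (norm (b k l))\<^sup>2)"
      by (simp only: parseval_grid[OF N2 T] mult.assoc flip: sum_distrib_left)
    also have "\<dots> \<le> real N1 * real N2 * D"
      using b unfolding D_def by (intro mult_left_mono sum_mono power_mono) auto
    finally show ?thesis
      by (simp add: G_def)
  qed
  have weight: "norm (of_real (real k / real N) ^ j :: complex) \<le> 1" if "k \<in> {1..N}" for k N j
    using that by (simp add: norm_power power_le_one del: of_real_divide)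
  define E1 where "E1 r k = e (real k * real (g N1 (x r)) / real N1)" for r and k :: nat
  define E2 where "E2 r l = e (real l * real (g N2 (y r)) / real N2)" for r and l :: nat
  define h1 :: "nat \<Rightarrow> complex" where "h1 k = of_real (real k / real N1)" for k
  define h2 :: "nat \<Rightarrow> complex" where "h2 l = of_real (real l / real N2)" for l
  \<comment> \<open>The rounding of \<open>y\<close> is removed first, with a fixed power of
    \<open>h1 k\<close> carried along. This is the uniform bound needed to remove the rounding of
    \<open>x\<close> by the same lemma.\<close>
  have *: "(\<Sum>r\<in>R. (norm (\<Sum>k\<in>S. h1 k ^ j * (\<Sum>l\<in>T. a k l * exp (h2 l * z N2 (y r)) * E1 r k * E2 r l)))\<^sup>2)
      \<le> exp (2 * (2 * pi)) * (real N1 * real N2 * D)" for j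
  proof -
    have "(\<Sum>r\<in>R. (norm (\<Sum>l\<in>T. exp (h2 l * z N2 (y r)) * (\<Sum>k\<in>S. h1 k ^ j * a k l * E1 r k * E2 r l)))\<^sup>2)
      \<le> exp (2 * (2 * pi)) * (real N1 * real N2 * D)"
    proof (rule sum_norm_square_exp_le[OF R])
      fix i
      have "(\<Sum>r\<in>R. (norm (\<Sum>k\<in>S. \<Sum>l\<in>T. (h1 k ^ j * h2 l ^ i * a k l) * (E2 r l * E1 r k)))\<^sup>2)
          \<le> real N1 * real N2 * D"
        unfolding E1_def E2_def
      proof (rule grid)
        fix k l assume "k \<in> S" "l \<in> T"
        then have "norm (h1 k ^ j) * norm (h2 l ^ i) \<le> 1 * 1"
          using S T unfolding h1_def h2_def by (intro mult_mono weight) auto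
        then show "norm (h1 k ^ j * h2 l ^ i * a k l) \<le> norm (a k l)"
          by (simp add: norm_mult mult_left_le_one_le)
      qed
      moreover have "(\<Sum>l\<in>T. h2 l ^ i * (\<Sum>k\<in>S. h1 k ^ j * a k l * E1 r k * E2 r l))
          = (\<Sum>k\<in>S. \<Sum>l\<in>T. (h1 k ^ j * h2 l ^ i * a k l) * (E2 r l * E1 r k))" for r
        unfolding sum_distrib_left
        by (subst sum.swap) (simp only: mult_ac)
      ultimately show "(\<Sum>r\<in>R. (norm (\<Sum>l\<in>T. h2 l ^ i * (\<Sum>k\<in>S. h1 k ^ j * a k l * E1 r k * E2 r l)))\<^sup>2)
          \<le> real N1 * real N2 * D"
        by simp
    qed (use z_le in auto)
    moreover have "(\<Sum>l\<in>T. exp (h2 l * z N2 (y r)) * (\<Sum>k\<in>S. h1 k ^ j * a k l * E1 r k * E2 r l))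
        = (\<Sum>k\<in>S. h1 k ^ j * (\<Sum>l\<in>T. a k l * exp (h2 l * z N2 (y r)) * E1 r k * E2 r l))" for r
      unfolding sum_distrib_left
      by (subst sum.swap) (simp only: mult_ac)
    ultimately show ?thesis
      by simp
  qed
  have e_split: "a k l * e (real k * x r + real l * y r) =
      exp (h1 k * z N1 (x r)) * (a k l * exp (h2 l * z N2 (y r)) * E1 r k * E2 r l)" for k l r
    by (simp only: e_add split[OF N1, of k "x r"] split[OF N2, of l "y r"]
        E1_def E2_def h1_def h2_def mult_ac)
  have "(\<Sum>r\<in>R. (norm (\<Sum>k\<in>S. exp (h1 k * z N1 (x r)) *
      (\<Sum>l\<in>T. a k l * exp (h2 l * z N2 (y r)) * E1 r k * E2 r l)))\<^sup>2)
      \<le> exp (2 * (2 * pi)) * (exp (2 * (2 * pi)) * (real N1 * real N2 * D))"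
    by (rule sum_norm_square_exp_le[OF R _ _ *]) (use z_le in auto)
  also have "\<dots> = exp (8 * pi) * real N1 * real N2 * D"
    by (simp flip: mult.assoc exp_add)
  finally show ?thesis
    by (simp only: e_split D_def flip: sum_distrib_left)
qed

section \<open>The cubic form: zeros, divisibility and size\<close>

text \<open>A 2-adic descent: \<open>c\<close>, \<open>b\<close>, \<open>a\<close> are successively forced to be even.\<close>

lemma cubic_form_eq_0:
  fixes a b c :: int
  assumes "4 * a ^ 3 + 2 * b ^ 3 + c ^ 3 = 6 * a * b * c"
  shows "a = 0 \<and> b = 0 \<and> c = 0"
  using assms
proof (induction "nat (\<bar>a\<bar> + \<bar>b\<bar> + \<bar>c\<bar>)" arbitrary: a b c rule: less_induct)
  case less
  have "c ^ 3 = 2 * (3 * a * b * c - 2 * a ^ 3 - b ^ 3)"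
    using less.prems by (simp add: algebra_simps)
  then have "even (c ^ 3)"
    by simp
  then obtain c' where c: "c = 2 * c'"
    by auto
  have "b ^ 3 = 2 * (3 * a * b * c' - a ^ 3 - 2 * c' ^ 3)"
    using less.prems by (simp add: c algebra_simps)
  then have "even (b ^ 3)"
    by simp
  then obtain b' where b: "b = 2 * b'"
    by auto
  have "a ^ 3 = 2 * (3 * a * b' * c' - 2 * b' ^ 3 - c' ^ 3)"
    using less.prems by (simp add: b c algebra_simps)
  then have "even (a ^ 3)"
    by simp
  then obtain a' where a: "a = 2 * a'"
    by auto
  show ?case
  proof (rule ccontr)
    assume "\<not> ?case"
    then have "nat (\<bar>a'\<bar> + \<bar>b'\<bar> + \<bar>c'\<bar>) < nat (\<bar>a\<bar> + \<bar>b\<bar> + \<bar>c\<bar>)"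
      by (auto simp: a b c)
    moreover have "4 * a' ^ 3 + 2 * b' ^ 3 + c' ^ 3 = 6 * a' * b' * c'"
      using less.prems by (simp add: a b c algebra_simps)
    ultimately have "a' = 0 \<and> b' = 0 \<and> c' = 0"
      by (rule less.hyps)
    with \<open>\<not> ?case\<close> show False
      by (simp add: a b c)
  qed
qed

text \<open>Here \<open>(a, b, c)\<close> is \<open>m * n\<close> times the difference of
  \<open>(1, x, x^2) / m\<close> and \<open>(1, y, y^2) / n\<close>, shifted by
  \<open>(0, s, t)\<close>. Since the form is homogeneous of degree 3, its value on the unscaled
  vector is an integer divided by \<open>m * n\<close>.\<close>

lemma cubic_form_dvd:
  fixes m n x y s t :: int
  assumes "[x ^ 3 = 2] (mod m)" and "[y ^ 3 = 2] (mod n)"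
  defines "a \<equiv> n - m" and "b \<equiv> n * x - m * y + m * n * s" and "c \<equiv> n * x\<^sup>2 - m * y\<^sup>2 + m * n * t"
  shows "(m * n)\<^sup>2 dvd 4 * a ^ 3 + 2 * b ^ 3 + c ^ 3 - 6 * a * b * c"
proof -
  obtain k where k: "x ^ 3 = 2 + m * k"
    using assms(1) by (metis cong_iff_lin cong_sym)
  obtain j where j: "y ^ 3 = 2 + n * j"
    using assms(2) by (metis cong_iff_lin cong_sym)
  \<comment> \<open>\<open>F\<close> is the form at \<open>(0, s, t)\<close>, \<open>G x\<close> its
    derivative there in the direction \<open>(1, x, x^2)\<close>, and \<open>H\<close> the polarised
    form on \<open>(1, x, x^2)\<close>, \<open>(1, y, y^2)\<close>, \<open>(0, s, t)\<close>. Their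
    terms carry \<open>(m * n)^2\<close> already; only the others need the congruences.\<close>
  define F where "F = 2 * s ^ 3 + t ^ 3"
  define G where "G x = 6 * s\<^sup>2 * x + 3 * t\<^sup>2 * x\<^sup>2 - 6 * s * t" for x
  define H where "H = 12 * x * y * s + 6 * x\<^sup>2 * y\<^sup>2 * t - 6 * (y * t + s * y\<^sup>2 + x * t + s * x\<^sup>2)"
  \<comment> \<open>Polarisation of the form: its value at \<open>(1, x, x\<^sup>2)\<close> is \<open>(x\<^sup>3 - 2)\<^sup>2\<close>, and its gradient there is
    \<open>(x\<^sup>3 - 2) (-6, 0, 3x)\<close>.\<close>
  have "4 * a ^ 3 + 2 * b ^ 3 + c ^ 3 - 6 * a * b * c =
      n ^ 3 * (x ^ 3 - 2)\<^sup>2 - m ^ 3 * (y ^ 3 - 2)\<^sup>2 + m ^ 3 * n ^ 3 * F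
      - n\<^sup>2 * m * (x ^ 3 - 2) * (3 * x * y\<^sup>2 - 6) + n * m\<^sup>2 * (y ^ 3 - 2) * (3 * y * x\<^sup>2 - 6)
      + 3 * n ^ 3 * m * (x ^ 3 - 2) * x * t + 3 * m ^ 3 * n * (y ^ 3 - 2) * y * t
      + m\<^sup>2 * n\<^sup>2 * (n * G x - m * G y) - m\<^sup>2 * n\<^sup>2 * H"
    unfolding a_def b_def c_def F_def G_def H_def by algebra
  also have "\<dots> = (m * n)\<^sup>2 *
     (n * k\<^sup>2 - m * j\<^sup>2 + m * n * F - k * (3 * x * y\<^sup>2 - 6) + j * (3 * y * x\<^sup>2 - 6)
      + 3 * n * k * x * t + 3 * m * j * y * t + n * G x - m * G y - H)"
    unfolding k j by algebra
  finally show ?thesis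
    by simp
qed

text \<open>Controls the entry \<open>1/m - 1/n\<close>, which no refinement of the grid makes smaller; this is what
  lets small \<open>M\<close> be treated uniformly.\<close>

lemma cube_diff_le:
  fixes m n :: int
  assumes "m < 2 * n" "n < 2 * m"
  shows "16 * \<bar>n - m\<bar> ^ 3 \<le> (m * n)\<^sup>2"
  using assms
proof (induction m n rule: linorder_wlog)
  case (le m n)
  define d where "d = n - m"
  have d: "0 \<le> d" "d + 1 \<le> m" and n: "n = m + d"
    using le by (auto simp: d_def)
  \<comment> \<open>The target \<open>16 * d^3\<close> is split as \<open>4 * d\<close> against
    \<open>m^2\<close> and \<open>4 * d^2\<close> against \<open>n^2\<close>.\<close>
  have "4 * d \<le> (d + 1)\<^sup>2"
    using zero_le_power2[of "d - 1"] by (simp add: power2_eq_square algebra_simps)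
  also have "\<dots> \<le> m\<^sup>2"
    using d by (intro power_mono) auto
  finally have m: "4 * d \<le> m\<^sup>2" .
  have "4 * d\<^sup>2 = (2 * d)\<^sup>2"
    by simp
  also have "\<dots> \<le> n\<^sup>2"
    using d n by (intro power_mono) auto
  finally have "(4 * d) * (4 * d\<^sup>2) \<le> m\<^sup>2 * n\<^sup>2"
    using m d by (intro mult_mono) auto
  then show ?case
    using d by (simp add: n power_mult_distrib power3_eq_cube power2_eq_square mult_ac)
next
  case (sym m n)
  then show ?case
    by (simp add: abs_minus_commute mult.commute)
qed

text \<open>Applied with \<open>P = m * n\<close>. The factor 1/2 ensures that a multiple of
  \<open>P^2\<close> within this bound is 0.\<close>

lemma cubic_form_bound:
  fixes M P a b c :: real
  assumes M: "M \<ge> 1" and P: "0 \<le> P" "P \<le> 4 * M\<^sup>2"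
    and a: "\<bar>a\<bar> \<le> M" "16 * \<bar>a\<bar> ^ 3 \<le> P\<^sup>2"
    and b: "\<bar>b\<bar> \<le> P / (8 * M)" and c: "\<bar>c\<bar> \<le> P / (8 * M)"
  shows "\<bar>4 * a ^ 3 + 2 * b ^ 3 + c ^ 3 - 6 * a * b * c\<bar> \<le> P\<^sup>2 / 2"
proof -
  define E where "E = P / (8 * M)"
  have E0: "0 \<le> E"
    using M P by (simp add: E_def)
  have "E \<le> M / 2"
    using M P by (simp add: E_def field_simps power2_eq_square)
  then have E3: "E ^ 3 \<le> M / 2 * E\<^sup>2"
    using E0 mult_right_mono[of E "M / 2" "E * E"] by (simp add: power3_eq_cube power2_eq_square mult.assoc)
  have E2: "M * E\<^sup>2 \<le> P\<^sup>2 / 64"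
  proof -
    have "M * E\<^sup>2 = P\<^sup>2 / 64 * (1 / M)"
      using M by (simp add: E_def power2_eq_square)
    also have "\<dots> \<le> P\<^sup>2 / 64 * 1"
      using M by (intro mult_left_mono) auto
    finally show ?thesis by simp
  qed
  have b3: "\<bar>b\<bar> ^ 3 \<le> E ^ 3" and c3: "\<bar>c\<bar> ^ 3 \<le> E ^ 3"
    using b c by (auto simp: E_def intro: power_mono)
  have "\<bar>a\<bar> * (\<bar>b\<bar> * \<bar>c\<bar>) \<le> M * (E * E)"
    using a b c M E0 by (intro mult_mono) (auto simp: E_def)
  then have abc: "\<bar>a * b * c\<bar> \<le> M * E\<^sup>2"
    by (simp add: abs_mult power2_eq_square mult.assoc)
  have "\<bar>4 * a ^ 3 + 2 * b ^ 3 + c ^ 3 - 6 * a * b * c\<bar>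
      \<le> 4 * \<bar>a\<bar> ^ 3 + 2 * \<bar>b\<bar> ^ 3 + \<bar>c\<bar> ^ 3 + 6 * \<bar>a * b * c\<bar>"
    unfolding power_abs[symmetric] by linarith
  \<comment> \<open>By \<open>E3\<close> and \<open>E2\<close> the last two terms total at most
    \<open>(3/128 + 6/64) * P^2\<close>, which is below \<open>P^2 / 4\<close>.\<close>
  also have "\<dots> \<le> P\<^sup>2 / 4 + 3 * E ^ 3 + 6 * (M * E\<^sup>2)"
    using a(2) b3 c3 abc by linarith
  also have "\<dots> \<le> P\<^sup>2 / 2"
    using E2 E3 zero_le_power2[of P] by linarith
  finally show ?thesis .
qed

section \<open>Separation of the points modulo 1\<close>

lemma cube_roots_of_2_separated:
  fixes M :: real and m n x y s t :: int
  assumes M: "M \<ge> 1" and m: "M < m" "m \<le> 2 * M" and n: "M < n" "n \<le> 2 * M"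
    and x: "x \<in> cube_roots_of_2_mod m" and y: "y \<in> cube_roots_of_2_mod n"
    and s: "\<bar>x / m - y / n + s\<bar> \<le> 1 / (8 * M)"
    and t: "\<bar>x\<^sup>2 / m - y\<^sup>2 / n + t\<bar> \<le> 1 / (8 * M)"
  shows "m = n \<and> x = y"
proof -
  define a where "a = n - m"
  define b where "b = n * x - m * y + m * n * s"
  define c where "c = n * x\<^sup>2 - m * y\<^sup>2 + m * n * t"
  define F where "F = 4 * a ^ 3 + 2 * b ^ 3 + c ^ 3 - 6 * a * b * c"
  have pos: "0 < m" "0 < n"
    using M m n by linarith+
  define P where "P = real_of_int m * of_int n"
  have P0: "0 < P"
    using pos by (simp add: P_def)
  have "P \<le> (2 * M) * (2 * M)"
    unfolding P_def using m n M by (intro mult_mono) auto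
  then have P: "P \<le> 4 * M\<^sup>2"
    by (simp add: power2_eq_square)
  have dvd: "(m * n)\<^sup>2 dvd F"
    using cubic_form_dvd[of x m y n s t] x y
    by (simp add: F_def a_def b_def c_def cube_roots_of_2_mod_def)
  have scale: "\<bar>real_of_int w\<bar> \<le> P / (8 * M)" if "real_of_int w = P * v" "\<bar>v\<bar> \<le> 1 / (8 * M)" for w v
    using mult_left_mono[OF that(2), of P] P0 that(1) by (simp add: abs_mult)
  have "\<bar>4 * real_of_int a ^ 3 + 2 * real_of_int b ^ 3 + real_of_int c ^ 3
      - 6 * real_of_int a * real_of_int b * real_of_int c\<bar> \<le> P\<^sup>2 / 2"
  proof (rule cubic_form_bound[OF M _ P])
    show "\<bar>real_of_int a\<bar> \<le> M"
      using m n by (simp add: a_def)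
    have "m < 2 * n" "n < 2 * m"
      using m n by linarith+
    then have "16 * \<bar>a\<bar> ^ 3 \<le> (m * n)\<^sup>2"
      unfolding a_def by (rule cube_diff_le)
    then have "real_of_int (16 * \<bar>a\<bar> ^ 3) \<le> of_int ((m * n)\<^sup>2)"
      by (simp only: of_int_le_iff)
    then show "16 * \<bar>real_of_int a\<bar> ^ 3 \<le> P\<^sup>2"
      by (simp add: P_def)
    show "\<bar>real_of_int b\<bar> \<le> P / (8 * M)"
      by (rule scale[OF _ s]) (use pos in \<open>simp add: b_def P_def field_simps\<close>)
    show "\<bar>real_of_int c\<bar> \<le> P / (8 * M)"
      by (rule scale[OF _ t]) (use pos in \<open>simp add: c_def P_def field_simps\<close>)
  qed (use P0 in simp)
  then have "\<bar>real_of_int F\<bar> \<le> P\<^sup>2 / 2"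
    by (simp add: F_def)
  also have "\<dots> < P\<^sup>2"
    using P0 by simp
  finally have "real_of_int \<bar>F\<bar> < of_int ((m * n)\<^sup>2)"
    by (simp add: P_def)
  then have "\<bar>F\<bar> < (m * n)\<^sup>2"
    by (simp only: of_int_less_iff)
  with dvd have "F = 0"
    using dvd_imp_le_int[of F "(m * n)\<^sup>2"] by fastforce
  then have 0: "a = 0" "b = 0"
    using cubic_form_eq_0[of a b c] by (simp_all add: F_def)
  then have mn: "n = m"
    by (simp add: a_def)
  with 0 have "m * (x - y + m * s) = 0"
    by (simp add: b_def algebra_simps)
  then have "x = y + m * - s"
    using pos by simp
  then have "x mod m = y mod m"
    by (simp only: mod_mult_self2)
  then show ?thesis
    using x y mn by (simp add: cube_roots_of_2_mod_def)
qed

text \<open>After an integer shift of \<open>u\<close> the scaled points have the same floor. This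
  turns a collision of cells into the closeness hypotheses of the separation lemma.\<close>

lemma same_cell_imp_close:
  fixes u v :: real and N :: nat
  assumes "N > 0" and "\<lfloor>N * u\<rfloor> mod int N = \<lfloor>N * v\<rfloor> mod int N"
  shows "\<exists>s::int. \<bar>u - v + s\<bar> \<le> 1 / N"
proof -
  obtain q where "\<lfloor>N * u\<rfloor> = \<lfloor>N * v\<rfloor> + int N * q"
    using assms(2) by (metis mod_eqE)
  then have "real_of_int \<lfloor>N * u\<rfloor> = \<lfloor>N * v\<rfloor> + N * q"
    by (metis of_int_add of_int_mult of_int_of_nat_eq)
  then have "\<bar>N * u - N * v - N * q\<bar> \<le> 1"
    by linarith
  moreover have "N * u - N * v - N * q = N * (u - v + of_int (- q))"
    by (simp add: algebra_simps)
  ultimately have "\<bar>u - v + of_int (- q)\<bar> \<le> 1 / N"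
    using assms(1) by (simp add: abs_mult pos_le_divide_eq mult.commute)
  then show ?thesis ..
qed

section \<open>The large sieve applied to the cube roots of 2\<close>

theorem theorem3:
  "\<exists>C::real. C > 0 \<and>
     (\<forall>(M::real) (K::real) (L::real) (a :: nat \<Rightarrow> nat \<Rightarrow> complex).
        M \<ge> 1 \<longrightarrow> K \<ge> 1 \<longrightarrow> L \<ge> 1 \<longrightarrow>
        (\<forall>k l. a k l \<noteq> 0 \<longrightarrow> 1 \<le> k \<and> real k \<le> K \<and> 1 \<le> l \<and> real l \<le> L) \<longrightarrow>
        (\<Sum>m\<in>{m::int. M < of_int m \<and> of_int m \<le> 2 * M}.
           \<Sum>\<nu>\<in>cube_roots_of_2_mod m.
             (cmod (\<Sum>k\<in>{k::nat. 1 \<le> k \<and> real k \<le> K}. \<Sum>l\<in>{l::nat. 1 \<le> l \<and> real l \<le> L}.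
                a k l * e (of_int (int k * \<nu> + int l * \<nu>\<^sup>2) / of_int m)))\<^sup>2)
        \<le> C * (M + K) * (M + L) *
           (\<Sum>k\<in>{k::nat. 1 \<le> k \<and> real k \<le> K}. \<Sum>l\<in>{l::nat. 1 \<le> l \<and> real l \<le> L}.
              (cmod (a k l))\<^sup>2))"
proof -
  have "(\<Sum>m\<in>{m::int. M < of_int m \<and> of_int m \<le> 2 * M}.
           \<Sum>\<nu>\<in>cube_roots_of_2_mod m.
             (cmod (\<Sum>k\<in>{k::nat. 1 \<le> k \<and> real k \<le> K}. \<Sum>l\<in>{l::nat. 1 \<le> l \<and> real l \<le> L}.
                a k l * e (of_int (int k * \<nu> + int l * \<nu>\<^sup>2) / of_int m)))\<^sup>2)
        \<le> 81 * exp (8 * pi) * (M + K) * (M + L) *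
           (\<Sum>k\<in>{k::nat. 1 \<le> k \<and> real k \<le> K}. \<Sum>l\<in>{l::nat. 1 \<le> l \<and> real l \<le> L}.
              (cmod (a k l))\<^sup>2)"
    if M: "M \<ge> 1" and K: "K \<ge> 1" and L: "L \<ge> 1" for M K L :: real and a :: "nat \<Rightarrow> nat \<Rightarrow> complex"
  proof -
    define I where "I = {m::int. M < of_int m \<and> of_int m \<le> 2 * M}"
    define R where "R = Sigma I cube_roots_of_2_mod"
    define S where "S = {k::nat. 1 \<le> k \<and> real k \<le> K}"
    define T where "T = {l::nat. 1 \<le> l \<and> real l \<le> L}"
    define D where "D = (\<Sum>k\<in>S. \<Sum>l\<in>T. (cmod (a k l))\<^sup>2)"
    define x :: "int \<times> int \<Rightarrow> real" where "x = (\<lambda>(m, \<nu>). \<nu> / m)"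
    define y :: "int \<times> int \<Rightarrow> real" where "y = (\<lambda>(m, \<nu>). \<nu>\<^sup>2 / m)"
    \<comment> \<open>The summand \<open>8 * M\<close> makes cells no wider than the separation
      \<open>1 / (8 * M)\<close>; the summand \<open>u\<close> lets all frequencies up to
      \<open>u\<close> fit in one period. As \<open>M\<close> is at least 1, rounding up stays
      within \<open>9 * (M + u)\<close>, and the two grids give \<open>81 = 9 * 9\<close>.\<close>
    define N where "N u = nat \<lceil>8 * M + u\<rceil>" for u
    have N: "0 < N u" "8 * M + u \<le> N u" "N u \<le> 9 * (M + u)" if "u \<ge> 1" for u
    proof -
      show "0 < N u" "8 * M + u \<le> N u"
        using M that unfolding N_def by linarith+
      have "N u \<le> 8 * M + u + 1"
        using M that unfolding N_def by linarith
      then show "N u \<le> 9 * (M + u)"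
        using M that by simp
    qed
    have inv_N: "1 / N u \<le> 1 / (8 * M)" if "u \<ge> 1" for u
      using N(2)[OF that] M that by (intro divide_left_mono) auto
    have "I \<subseteq> {\<lfloor>M\<rfloor>..\<lceil>2 * M\<rceil>}"
      unfolding I_def by (auto; linarith)
    then have fin_I: "finite I"
      using finite_subset by blast
    have fin_roots: "finite (cube_roots_of_2_mod m)" for m
      by (rule finite_subset[of _ "{0..<m}"]) (auto simp: cube_roots_of_2_mod_def)
    have inj: "inj_on (\<lambda>r. (\<lfloor>N K * x r\<rfloor> mod int (N K), \<lfloor>N L * y r\<rfloor> mod int (N L))) R"
    proof (rule inj_onI)
      fix r r' assume r: "r \<in> R" "r' \<in> R"
        and eq: "(\<lfloor>N K * x r\<rfloor> mod int (N K), \<lfloor>N L * y r\<rfloor> mod int (N L))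
          = (\<lfloor>N K * x r'\<rfloor> mod int (N K), \<lfloor>N L * y r'\<rfloor> mod int (N L))"
      obtain s where s: "\<bar>x r - x r' + of_int s\<bar> \<le> 1 / N K"
        using same_cell_imp_close[OF N(1)[OF K]] eq by blast
      obtain t where t: "\<bar>y r - y r' + of_int t\<bar> \<le> 1 / N L"
        using same_cell_imp_close[OF N(1)[OF L]] eq by blast
      obtain m \<nu> n \<mu> where [simp]: "r = (m, \<nu>)" "r' = (n, \<mu>)"
        by fastforce
      have "m = n \<and> \<nu> = \<mu>"
      proof (rule cube_roots_of_2_separated[OF M])
        show "\<bar>\<nu> / m - \<mu> / n + s\<bar> \<le> 1 / (8 * M)"
          using s inv_N[OF K] by (simp add: x_def)
        show "\<bar>\<nu>\<^sup>2 / m - \<mu>\<^sup>2 / n + t\<bar> \<le> 1 / (8 * M)"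
          using t inv_N[OF L] by (simp add: y_def)
      qed (use r in \<open>auto simp: R_def I_def\<close>)
      then show "r = r'" by simp
    qed
    have "(\<Sum>m\<in>I. \<Sum>\<nu>\<in>cube_roots_of_2_mod m.
          (cmod (\<Sum>k\<in>S. \<Sum>l\<in>T. a k l * e (of_int (int k * \<nu> + int l * \<nu>\<^sup>2) / of_int m)))\<^sup>2)
        = (\<Sum>r\<in>R. (cmod (\<Sum>k\<in>S. \<Sum>l\<in>T. a k l * e (real k * x r + real l * y r)))\<^sup>2)"
      unfolding R_def using fin_I fin_roots
      by (subst sum.Sigma) (auto simp: x_def y_def add_divide_distrib intro!: sum.cong)
    also have "\<dots> \<le> exp (8 * pi) * real (N K) * real (N L) * D"
      unfolding D_def
    proof (rule large_sieve_grid[OF _ N(1)[OF K] N(1)[OF L] _ _ inj])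
      show "finite R"
        using fin_I fin_roots by (simp add: R_def)
      show "S \<subseteq> {1..N K}"
        using N(2)[OF K] M by (auto simp: S_def)
      show "T \<subseteq> {1..N L}"
        using N(2)[OF L] M by (auto simp: T_def)
    qed
    also have "\<dots> \<le> exp (8 * pi) * (9 * (M + K)) * (9 * (M + L)) * D"
      using N(3)[OF K] N(3)[OF L] M K L unfolding D_def
      by (intro mult_right_mono mult_mono sum_nonneg) auto
    also have "\<dots> = 81 * exp (8 * pi) * (M + K) * (M + L) * D"
      by (simp add: algebra_simps)
    finally show ?thesis
      by (simp only: I_def S_def T_def D_def)
  qed
  then show ?thesis
    by (intro exI[of _ "81 * exp (8 * pi)"]) auto
qed

end
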